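(* Let $n>0$. Then the poset $(\mathcal{W}(S_n),\leqslant_R)$ is isomorphic to the product poset $(S_{\lceil n/2\rceil},\leqslant_R)\times\mathcal{P}([\lfloor n/2\rfloor])$, where $\mathcal{P}([\lfloor n/2\rfloor])$ is ordered by inclusion. In particular, $(\mathcal{W}(S_n),\leqslant_R)$ is a complemented lattice.
   Context: $S_k$ is the symmetric group on $[k]$ with simple generators the adjacent transpositions $s_i=(i,i+1)$ and length $\ell$ = number of inversions. The right weak order $\leqslant_R$ on $S_k$ is the partial order generated by the covers $u\vartriangleleft_R us_i$ whenever $\ell(us_i)=\ell(u)+1$. For $i\in[n]$ let $i^*=i-1$ if $i$ even, $i^*=i+1$ if $i$ odd and $i+1\le n$, $i^*=n$ otherwise. The Wachs permutations are $\mathcal{W}(S_n)=\{\sigma\in S_n: |\sigma^{-1}(i)-\sigma^{-1}(i^* )|\le1\ \forall i\in[n-1]\}$, ordered by the restriction of $\leqslant_R$ on $S_n$. *)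

theory Defs
  imports Complex_Main "HOL-Algebra.Sym_Groups" "HOL-Algebra.Lattice"
begin

definition inversions :: "nat \<Rightarrow> (nat \<Rightarrow> nat) \<Rightarrow> (nat \<times> nat) set" where
  "inversions k u = {(i, j). i \<in> {1..k} \<and> j \<in> {1..k} \<and> i < j \<and> u j < u i}"

definition perm_length :: "nat \<Rightarrow> (nat \<Rightarrow> nat) \<Rightarrow> nat" where
  "perm_length k u = card (inversions k u)"

definition weak_cover :: "nat \<Rightarrow> (nat \<Rightarrow> nat) \<Rightarrow> (nat \<Rightarrow> nat) \<Rightarrow> bool" where
  "weak_cover k u v \<longleftrightarrow> u \<in> carrier (sym_group k) \<and>
     (\<exists>i \<in> {1..<k}. v = u \<otimes>\<^bsub>sym_group k\<^esub> transpose i (i + 1) \<and>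
                     perm_length k v = perm_length k u + 1)"

definition weak_le :: "nat \<Rightarrow> (nat \<Rightarrow> nat) \<Rightarrow> (nat \<Rightarrow> nat) \<Rightarrow> bool" where
  "weak_le k = (weak_cover k)\<^sup>*\<^sup>*"

definition weak_order :: "nat \<Rightarrow> (nat \<Rightarrow> nat) gorder" where
  "weak_order k = \<lparr>carrier = carrier (sym_group k), eq = (=), le = weak_le k\<rparr>"

definition wachs_star :: "nat \<Rightarrow> nat \<Rightarrow> nat" where
  "wachs_star n i = (if even i then i - 1 else if i + 1 \<le> n then i + 1 else n)"

definition wachs_perms :: "nat \<Rightarrow> (nat \<Rightarrow> nat) set" where
  "wachs_perms n = {\<sigma> \<in> carrier (sym_group n).
     \<forall>i \<in> {1..n - 1}. \<bar>int (inv_into UNIV \<sigma> i) - int (inv_into UNIV \<sigma> (wachs_star n i))\<bar> \<le> 1}"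

definition wachs_order :: "nat \<Rightarrow> (nat \<Rightarrow> nat) gorder" where
  "wachs_order n = \<lparr>carrier = wachs_perms n, eq = (=), le = weak_le n\<rparr>"

definition powerset_order :: "'a set \<Rightarrow> 'a set gorder" where
  "powerset_order A = \<lparr>carrier = Pow A, eq = (=), le = (\<subseteq>)\<rparr>"

definition prod_gorder :: "('a, 'c) gorder_scheme \<Rightarrow> ('b, 'd) gorder_scheme \<Rightarrow> ('a \<times> 'b) gorder" where
  "prod_gorder A B =
     \<lparr>carrier = carrier A \<times> carrier B,
      eq = (\<lambda>x y. fst x .=\<^bsub>A\<^esub> fst y \<and> snd x .=\<^bsub>B\<^esub> snd y),
      le = (\<lambda>x y. fst x \<sqsubseteq>\<^bsub>A\<^esub> fst y \<and> snd x \<sqsubseteq>\<^bsub>B\<^esub> snd y)\<rparr>"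

text \<open>\<^const>\<open>order_emb\<close> also asserts that both structures are (weak) partial orders.\<close>

definition poset_isomorphic :: "('a, 'c) gorder_scheme \<Rightarrow> ('b, 'd) gorder_scheme \<Rightarrow> bool" where
  "poset_isomorphic A B \<longleftrightarrow>
     (\<exists>f. bij_betw f (carrier A) (carrier B) \<and> order_emb A B f)"

locale complemented_lattice = Lattice.bounded_lattice +
  assumes complement_exists:
    "x \<in> carrier L \<Longrightarrow> \<exists>y \<in> carrier L. x \<squnion> y = \<top> \<and> x \<sqinter> y = \<bottom>"

end

theory Submission
  imports Defs
begin

text \<open>
  A permutation \<open>u\<close> is determined by its set of value inversions, the pairs \<open>a < b\<close> such that \<open>b\<close> is
  placed before \<open>a\<close>. The right weak order is inclusion of these sets, and the sets that occur are
  exactly the biclosed ones: transitive, with transitive complement. The transitive closure of a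
  union of two biclosed sets is biclosed, which gives joins; complementation gives meets and
  lattice complements.

  In a Wachs permutation the blocks \<open>{1, 2}\<close>, \<open>{3, 4}\<close>, \<dots> occupy consecutive positions. Whether
  two values of different blocks are inverted depends only on their blocks, so the value inversions
  amount to a biclosed set on the blocks together with an arbitrary set of flipped two-element blocks.
\<close>

section \<open>Value inversions of permutations\<close>

abbreviation pos :: "(nat \<Rightarrow> nat) \<Rightarrow> nat \<Rightarrow> nat" where
  "pos u \<equiv> inv_into UNIV u"

definition value_pairs :: "nat \<Rightarrow> (nat \<times> nat) set" where
  "value_pairs k = {(a, b). 1 \<le> a \<and> a < b \<and> b \<le> k}"

text \<open>Pairs of values are recorded rather than pairs of positions because right multiplication
  by an adjacent transposition exchanges two neighbouring entries. That alters a single pair of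
  values, whereas it relabels many position pairs.\<close>

definition value_inversions :: "nat \<Rightarrow> (nat \<Rightarrow> nat) \<Rightarrow> (nat \<times> nat) set" where
  "value_inversions k u = {(a, b) \<in> value_pairs k. pos u b < pos u a}"

text \<open>The last condition is transitivity of the complement within
  \<open>value_pairs k\<close>, stated contrapositively. These are the biclosed sets of positive
  roots in type A.\<close>

definition biclosed :: "nat \<Rightarrow> (nat \<times> nat) set \<Rightarrow> bool" where
  "biclosed k I \<longleftrightarrow> I \<subseteq> value_pairs k \<and> trans I \<and>
     (\<forall>a b c. (a, c) \<in> I \<longrightarrow> a < b \<longrightarrow> b < c \<longrightarrow> (a, b) \<in> I \<or> (b, c) \<in> I)"

lemma finite_value_pairs: "finite (value_pairs k)"
proof (rule finite_subset)
  show "value_pairs k \<subseteq> {1..k} \<times> {1..k}" by (auto simp: value_pairs_def)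
qed simp

lemma finite_value_inversions: "finite (value_inversions k u)"
  by (rule finite_subset[OF _ finite_value_pairs]) (auto simp: value_inversions_def)

lemma value_inversions_subset: "value_inversions k u \<subseteq> value_pairs k"
  by (auto simp: value_inversions_def)

lemma pos_apply: "u permutes {1..k} \<Longrightarrow> pos u (u i) = i"
  by (simp add: permutes_inverses)

lemma apply_pos: "u permutes {1..k} \<Longrightarrow> u (pos u a) = a"
  by (simp add: permutes_inverses)

lemma pos_eq_iff: "u permutes {1..k} \<Longrightarrow> pos u a = pos u b \<longleftrightarrow> a = b"
  by (metis apply_pos)

lemma pos_less_swap: "u permutes {1..k} \<Longrightarrow> a \<noteq> b \<Longrightarrow> \<not> pos u a < pos u b \<longleftrightarrow> pos u b < pos u a"
  using pos_eq_iff[of u k a b] by linarith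

lemma biclosed_value_inversions: "u permutes {1..k} \<Longrightarrow> biclosed k (value_inversions k u)"
  unfolding biclosed_def value_inversions_def trans_def value_pairs_def
  by (auto intro: less_trans)

lemma perm_length_eq_card:
  assumes u: "u permutes {1..k}"
  shows "perm_length k u = card (value_inversions k u)"
proof -
  have mem: "1 \<le> u i \<and> u i \<le> k" if "1 \<le> i" "i \<le> k" for i
    using permutes_in_image[OF u, of i] that by simp
  have mem': "1 \<le> pos u i \<and> pos u i \<le> k" if "1 \<le> i" "i \<le> k" for i
    using permutes_in_image[OF permutes_inv[OF u], of i] that by simp
  have "bij_betw (\<lambda>(i, j). (u j, u i)) (inversions k u) (value_inversions k u)"
  proof (rule bij_betw_byWitness[where f' = "\<lambda>(a, b). (pos u b, pos u a)"])
    show "(\<lambda>(i, j). (u j, u i)) ` inversions k u \<subseteq> value_inversions k u"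
      by (auto simp del: One_nat_def simp: inversions_def value_inversions_def value_pairs_def
          pos_apply[OF u] mem)
    show "(\<lambda>(a, b). (pos u b, pos u a)) ` value_inversions k u \<subseteq> inversions k u"
      by (auto simp del: One_nat_def simp: inversions_def value_inversions_def value_pairs_def
          apply_pos[OF u] mem')
  qed (auto simp: pos_apply[OF u] apply_pos[OF u])
  then show ?thesis
    unfolding perm_length_def by (rule bij_betw_same_card)
qed

section \<open>The right weak order as inclusion of value inversions\<close>

text \<open>The hypothesis makes \<open>pos v \<circ> u\<close> strictly increasing on
  \<open>{1..k}\<close>, hence at least the identity there, and a permutation of
  \<open>{1..k}\<close> with this property is the identity.\<close>

lemma eq_if_pos_increasing:
  assumes u: "u permutes {1..k}" and v: "v permutes {1..k}"
    and step: "\<And>i. i \<in> {1..<k} \<Longrightarrow> pos v (u i) < pos v (u (i + 1))"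
  shows "u = v"
proof -
  have p: "(pos v \<circ> u) permutes {1..k}"
    by (rule permutes_compose[OF u permutes_inv[OF v]])
  have ge: "i \<in> {1..k} \<Longrightarrow> (pos v \<circ> u) i \<ge> i" for i
  proof (induction i)
    case (Suc i)
    show ?case
    proof (cases "i = 0")
      case True
      then show ?thesis
        using Suc.prems permutes_in_image[OF p, of "Suc i"] by auto
    next
      case False
      then show ?thesis
        using Suc step[of i] by auto
    qed
  qed simp
  have "pos v \<circ> u = id"
    by (rule permutes_natset_ge[OF p]) (use ge in auto)
  then show ?thesis
    by (metis apply_pos[OF v] comp_apply ext id_apply)
qed

text \<open>Supplies one upward step from \<open>u\<close> towards \<open>v\<close>. As
  \<open>u\<close> and \<open>v\<close> differ, some two neighbouring entries of \<open>u\<close>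
  appear in \<open>v\<close> in the opposite order. They must form an ascent of \<open>u\<close>,
  since otherwise they would give an inversion of \<open>u\<close> that \<open>v\<close>
  lacks.\<close>

lemma ascent_exists:
  assumes u: "u permutes {1..k}" and v: "v permutes {1..k}"
    and sub: "value_inversions k u \<subseteq> value_inversions k v" and "u \<noteq> v"
  obtains i where "i \<in> {1..<k}" "u i < u (i + 1)" "(u i, u (i + 1)) \<in> value_inversions k v"
proof -
  obtain i where i: "i \<in> {1..<k}" and ni: "\<not> pos v (u i) < pos v (u (i + 1))"
    using eq_if_pos_increasing[OF u v] \<open>u \<noteq> v\<close> by blast
  have mem: "u i \<in> {1..k}" "u (i + 1) \<in> {1..k}"
    using i permutes_in_image[OF u] by auto
  have ne: "u i \<noteq> u (i + 1)"
    by (metis pos_apply[OF u] n_not_Suc_n Suc_eq_plus1)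
  have less: "pos v (u (i + 1)) < pos v (u i)"
    using ni ne pos_less_swap[OF v] by blast
  have asc: "u i < u (i + 1)"
  proof (rule ccontr)
    assume "\<not> u i < u (i + 1)"
    then have "(u (i + 1), u i) \<in> value_inversions k u"
      using mem ne by (auto simp: value_inversions_def value_pairs_def pos_apply[OF u] less_le)
    then show False
      using sub less by (auto simp: value_inversions_def)
  qed
  then show thesis
    using that i mem less by (auto simp: value_inversions_def value_pairs_def)
qed

lemma value_inversions_inject:
  assumes u: "u permutes {1..k}" and v: "v permutes {1..k}"
    and eq: "value_inversions k u = value_inversions k v"
  shows "u = v"
proof (rule ccontr)
  assume "u \<noteq> v"
  then obtain i where "u i < u (i + 1)" "(u i, u (i + 1)) \<in> value_inversions k v"
    using ascent_exists[OF u v] eq by auto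
  then show False
    unfolding eq[symmetric] by (auto simp: value_inversions_def pos_apply[OF u])
qed

lemma permutes_comp_adjacent:
  fixes k :: nat
  assumes "u permutes {1..k}" "i \<in> {1..<k}"
  shows "(u \<circ> transpose i (i + 1)) permutes {1..k}"
  by (rule permutes_compose[OF permutes_swap_id assms(1)]) (use assms(2) in auto)

lemma pos_comp_adjacent:
  assumes "u permutes {1..k}"
  shows "pos (u \<circ> transpose i (i + 1)) a = transpose i (i + 1) (pos u a)"
proof -
  have "inv_into UNIV (u \<circ> transpose i (i + 1)) = transpose i (i + 1) \<circ> pos u"
    by (rule inv_unique_comp) (simp_all add: fun_eq_iff apply_pos[OF assms] pos_apply[OF assms])
  then show ?thesis by simp
qed

text \<open>Every other value lies on the same side of both exchanged entries, so only their mutual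
  order changes.\<close>

lemma value_inversions_ascent:
  assumes u: "u permutes {1..k}" and i: "i \<in> {1..<k}" and asc: "u i < u (i + 1)"
  shows "value_inversions k (u \<circ> transpose i (i + 1)) = insert (u i, u (i + 1)) (value_inversions k u)"
    and "(u i, u (i + 1)) \<notin> value_inversions k u"
proof -
  have mem: "u i \<in> {1..k}" "u (i + 1) \<in> {1..k}"
    using i permutes_in_image[OF u] by auto
  have key: "transpose i (i + 1) (pos u b) < transpose i (i + 1) (pos u a) \<longleftrightarrow>
      (a = u i \<and> b = u (i + 1)) \<or> pos u b < pos u a" if "a < b" for a b
  proof -
    \<comment> \<open>Naming the positions of \<open>a\<close> and \<open>b\<close> reduces the
      claim to a case analysis on whether each of them is \<open>i\<close>, \<open>i + 1\<close> or
      neither.\<close>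
    obtain x y where "a = u x" "b = u y"
      using apply_pos[OF u] by metis
    moreover have "u r = u s \<longleftrightarrow> r = s" for r s
      using pos_apply[OF u] by metis
    ultimately show ?thesis
      using that asc by (auto simp: transpose_def pos_apply[OF u])
  qed
  show "value_inversions k (u \<circ> transpose i (i + 1)) = insert (u i, u (i + 1)) (value_inversions k u)"
    unfolding value_inversions_def value_pairs_def pos_comp_adjacent[OF u]
    using key mem asc by auto
  show "(u i, u (i + 1)) \<notin> value_inversions k u"
    by (auto simp: value_inversions_def pos_apply[OF u])
qed

lemma weak_cover_value_inversions:
  assumes "weak_cover k u v"
  shows "u permutes {1..k} \<and> v permutes {1..k} \<and> value_inversions k u \<subseteq> value_inversions k v"
proof -
  obtain i where u: "u permutes {1..k}" and i: "i \<in> {1..<k}" and v: "v = u \<circ> transpose i (i + 1)"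
    and len: "perm_length k v = perm_length k u + 1"
    using assms by (auto simp: weak_cover_def sym_group_carrier sym_group_mult)
  have vp: "v permutes {1..k}"
    unfolding v by (rule permutes_comp_adjacent[OF u i])
  \<comment> \<open>The transposition is an involution, so if \<open>i\<close> were a descent of
    \<open>u\<close> it would be an ascent of \<open>v\<close>, and \<open>u\<close> would arise
    from \<open>v\<close> by adding an inversion. The length condition excludes this.\<close>
  have u': "u = v \<circ> transpose i (i + 1)"
    by (simp add: v comp_assoc)
  have "u i < u (i + 1)"
  proof (rule ccontr)
    assume "\<not> u i < u (i + 1)"
    moreover have "u i \<noteq> u (i + 1)"
      by (metis pos_apply[OF u] n_not_Suc_n Suc_eq_plus1)
    ultimately have "v i < v (i + 1)"
      by (simp add: v)
    then have "value_inversions k v \<subseteq> value_inversions k u"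
      using value_inversions_ascent(1)[OF vp i] u' by auto
    then have "perm_length k v \<le> perm_length k u"
      unfolding perm_length_eq_card[OF u] perm_length_eq_card[OF vp]
      by (rule card_mono[OF finite_value_inversions])
    then show False using len by simp
  qed
  then show ?thesis
    using u vp value_inversions_ascent(1)[OF u i] v by auto
qed

text \<open>Covers enlarge the set of value inversions, which gives one direction. For the other,
  induct on the number of inversions of \<open>v\<close> missing in \<open>u\<close>: exchanging an
  ascent of \<open>u\<close> that is inverted in \<open>v\<close> is a cover and leaves fewer
  missing.\<close>

theorem weak_le_iff:
  assumes u: "u permutes {1..k}" and v: "v permutes {1..k}"
  shows "weak_le k u v \<longleftrightarrow> value_inversions k u \<subseteq> value_inversions k v"
proof
  assume "weak_le k u v"
  then show "value_inversions k u \<subseteq> value_inversions k v"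
    unfolding weak_le_def
    by (induction rule: rtranclp_induct) (use weak_cover_value_inversions in blast)+
next
  assume "value_inversions k u \<subseteq> value_inversions k v"
  then show "weak_le k u v"
    using u
  proof (induction "card (value_inversions k v - value_inversions k u)" arbitrary: u rule: less_induct)
    case less
    note u = less.prems(2) and sub = less.prems(1)
    show ?case
    proof (cases "u = v")
      case True
      then show ?thesis by (simp add: weak_le_def)
    next
      case False
      obtain i where i: "i \<in> {1..<k}" and asc: "u i < u (i + 1)"
        and inv: "(u i, u (i + 1)) \<in> value_inversions k v"
        using ascent_exists[OF u v sub False] .
      define w where "w = u \<circ> transpose i (i + 1)"
      have wp: "w permutes {1..k}"
        unfolding w_def by (rule permutes_comp_adjacent[OF u i])
      have w: "value_inversions k w = insert (u i, u (i + 1)) (value_inversions k u)"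
        and new: "(u i, u (i + 1)) \<notin> value_inversions k u"
        unfolding w_def by (rule value_inversions_ascent[OF u i asc])+
      have "perm_length k w = perm_length k u + 1"
        using new by (simp add: perm_length_eq_card[OF u] perm_length_eq_card[OF wp] w finite_value_inversions)
      then have cover: "weak_cover k u w"
        using u i by (auto simp: weak_cover_def sym_group_carrier sym_group_mult w_def)
      have "value_inversions k v - value_inversions k w \<subset> value_inversions k v - value_inversions k u"
        using w new inv by blast
      then have "card (value_inversions k v - value_inversions k w)
          < card (value_inversions k v - value_inversions k u)"
        by (intro psubset_card_mono) (simp_all add: finite_value_inversions)
      moreover have "value_inversions k w \<subseteq> value_inversions k v"
        using w inv sub by simp
      ultimately have "weak_le k w v"
        using less.hyps wp by blast
      then show ?thesis
        using cover by (simp add: weak_le_def converse_rtranclp_into_rtranclp)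
    qed
  qed
qed

section \<open>Biclosed sets are exactly the sets of value inversions\<close>

lemma linear_order_permutation:
  fixes R :: "nat \<Rightarrow> nat \<Rightarrow> bool"
  assumes irrefl: "\<And>a. \<not> R a a"
    and trans: "\<And>a b c. a \<in> {1..k} \<Longrightarrow> b \<in> {1..k} \<Longrightarrow> c \<in> {1..k} \<Longrightarrow> R a b \<Longrightarrow> R b c \<Longrightarrow> R a c"
    and total: "\<And>a b. a \<in> {1..k} \<Longrightarrow> b \<in> {1..k} \<Longrightarrow> a \<noteq> b \<Longrightarrow> R a b \<or> R b a"
  obtains u where "u permutes {1..k}"
    and "\<And>a b. a \<in> {1..k} \<Longrightarrow> b \<in> {1..k} \<Longrightarrow> pos u a < pos u b \<longleftrightarrow> R a b"
proof -
  \<comment> \<open>The down-set of \<open>a\<close> contains \<open>a\<close> itself, so ranks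
    start at 1. The rank function \<open>p\<close> is the identity outside \<open>{1..k}\<close>, as
    \<open>permutes\<close> demands, and the wanted permutation is its inverse, because
    \<open>pos\<close> of that inverse is \<open>p\<close>.\<close>
  define D where "D a = {c \<in> {1..k}. R c a \<or> c = a}" for a
  define p where "p a = (if a \<in> {1..k} then card (D a) else a)" for a
  have fin: "finite (D a)" for a by (simp add: D_def)
  have mono: "p a < p b" if "a \<in> {1..k}" "b \<in> {1..k}" "R a b" for a b
  proof -
    have "b \<notin> D a"
      unfolding D_def using that irrefl trans by blast
    moreover have "D a \<subseteq> D b" "b \<in> D b"
      unfolding D_def using that trans by blast+
    ultimately have "card (D a) < card (D b)"
      by (intro psubset_card_mono[OF fin]) blast
    then show ?thesis
      using that by (simp add: p_def)
  qed
  have iff: "p a < p b \<longleftrightarrow> R a b" if "a \<in> {1..k}" "b \<in> {1..k}" for a b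
    using that mono total by (metis less_asym less_irrefl)
  have "inj_on p {1..k}"
    by (rule inj_onI) (metis iff total less_irrefl)
  moreover have "p ` {1..k} \<subseteq> {1..k}"
  proof
    fix x assume "x \<in> p ` {1..k}"
    then obtain a where a: "a \<in> {1..k}" "x = card (D a)" by (auto simp: p_def)
    then have "card {a} \<le> card (D a)"
      by (intro card_mono[OF fin]) (auto simp: D_def)
    moreover have "card (D a) \<le> card {1..k}"
      by (intro card_mono) (auto simp: D_def)
    ultimately show "x \<in> {1..k}" using a by simp
  qed
  ultimately have "bij_betw p {1..k} {1..k}"
    by (simp add: bij_betw_def endo_inj_surj)
  then have p: "p permutes {1..k}"
    by (rule bij_imp_permutes) (auto simp: p_def)
  show thesis
    using that[OF permutes_inv[OF p]] iff unfolding permutes_inv_inv[OF p] by blast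
qed

text \<open>Start from the natural order and reverse exactly the pairs in \<open>I\<close>.
  Biclosedness makes the resulting relation \<open>R\<close> transitive, so \<open>R\<close> is a
  strict linear order in which the values can be listed.\<close>

lemma biclosed_realized:
  assumes "biclosed k I"
  obtains u where "u permutes {1..k}" "value_inversions k u = I"
proof -
  define R where "R a b \<longleftrightarrow> (a < b \<and> (a, b) \<notin> I) \<or> (b < a \<and> (b, a) \<in> I)" for a b
  have sub: "I \<subseteq> value_pairs k"
    and tr: "\<And>a b c. (a, b) \<in> I \<Longrightarrow> (b, c) \<in> I \<Longrightarrow> (a, c) \<in> I"
    and cotr: "\<And>a b c. (a, c) \<in> I \<Longrightarrow> a < b \<Longrightarrow> b < c \<Longrightarrow> (a, b) \<in> I \<or> (b, c) \<in> I"
    using assms unfolding biclosed_def trans_def by blast+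
  \<comment> \<open>The six instances of \<open>tr\<close> and \<open>cotr\<close> serve the six
    possible orderings of three distinct values \<open>a\<close>, \<open>b\<close>,
    \<open>c\<close>, one each; \<open>a = c\<close> is contradictory.\<close>
  have Rtrans: "R a c" if "R a b" "R b c" for a b c
    using that cotr[of a c b] tr[of a c b] tr[of b a c] cotr[of c b a] cotr[of b a c] tr[of c b a]
    unfolding R_def by (cases a c rule: linorder_cases) auto
  have Rtotal: "R a b \<or> R b a" if "a \<noteq> b" for a b
    using that by (auto simp: R_def)
  have Rirrefl: "\<not> R a a" for a
    by (simp add: R_def)
  obtain u where u: "u permutes {1..k}"
    and lt: "\<And>a b. a \<in> {1..k} \<Longrightarrow> b \<in> {1..k} \<Longrightarrow> pos u a < pos u b \<longleftrightarrow> R a b"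
    by (rule linear_order_permutation[of R k, OF Rirrefl Rtrans Rtotal]) blast+
  have "value_inversions k u = I"
    using sub lt by (auto simp: value_inversions_def value_pairs_def R_def)
  then show thesis
    using that u by blast
qed

definition perm_of_inversions :: "nat \<Rightarrow> (nat \<times> nat) set \<Rightarrow> nat \<Rightarrow> nat" where
  "perm_of_inversions k I = (THE u. u permutes {1..k} \<and> value_inversions k u = I)"

lemma perm_of_inversions:
  assumes "biclosed k I"
  shows "perm_of_inversions k I permutes {1..k} \<and> value_inversions k (perm_of_inversions k I) = I"
  unfolding perm_of_inversions_def
proof (rule theI'[where P = "\<lambda>u. u permutes {1..k} \<and> value_inversions k u = I"])
  obtain u where "u permutes {1..k}" "value_inversions k u = I"
    by (rule biclosed_realized[OF assms])
  then show "\<exists>!u. u permutes {1..k} \<and> value_inversions k u = I"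
    by (intro ex1I[of _ u]) (auto intro: value_inversions_inject)
qed

lemma perm_of_value_inversions:
  "u permutes {1..k} \<Longrightarrow> perm_of_inversions k (value_inversions k u) = u"
  using perm_of_inversions[OF biclosed_value_inversions, of u k] value_inversions_inject by blast

section \<open>Operations on biclosed sets\<close>

lemma biclosed_empty: "biclosed k {}"
  by (simp add: biclosed_def)

text \<open>The two closure conditions exchange roles. On permutations this corresponds to reversing
  the word.\<close>

lemma biclosed_complement:
  assumes "biclosed k I"
  shows "biclosed k (value_pairs k - I)"
proof -
  have tr: "\<And>a b c. (a, b) \<in> I \<Longrightarrow> (b, c) \<in> I \<Longrightarrow> (a, c) \<in> I"
    and cotr: "\<And>a b c. (a, c) \<in> I \<Longrightarrow> a < b \<Longrightarrow> b < c \<Longrightarrow> (a, b) \<in> I \<or> (b, c) \<in> I"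
    using assms unfolding biclosed_def trans_def by blast+
  have "(a, c) \<in> value_pairs k - I" if "(a, b) \<in> value_pairs k - I" "(b, c) \<in> value_pairs k - I" for a b c
    using that cotr[of a c b] by (auto simp: value_pairs_def)
  moreover have "(a, b) \<in> value_pairs k - I \<or> (b, c) \<in> value_pairs k - I"
    if "(a, c) \<in> value_pairs k - I" "a < b" "b < c" for a b c
    using that tr[of a b c] by (auto simp: value_pairs_def)
  ultimately show ?thesis
    unfolding biclosed_def trans_def by blast
qed

text \<open>The union already satisfies the splitting condition, and only transitivity has to be
  forced. Splitting survives the closure: along a chain from \<open>a\<close> to \<open>c\<close>,
  an intermediate \<open>b\<close> is either met by the chain or jumped over by one edge, and that
  edge can be split.\<close>

lemma biclosed_trancl_Un:
  assumes A: "biclosed k A" and B: "biclosed k B"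
  shows "biclosed k ((A \<union> B)\<^sup>+)"
proof -
  have sub: "A \<union> B \<subseteq> value_pairs k"
    using A B by (auto simp: biclosed_def)
  have "(A \<union> B)\<^sup>+ \<subseteq> (value_pairs k)\<^sup>+"
    by (rule trancl_mono_subset[OF sub])
  also have "\<dots> = value_pairs k"
    by (rule trancl_id) (auto simp: trans_def value_pairs_def)
  finally have pairs: "(A \<union> B)\<^sup>+ \<subseteq> value_pairs k" .
  have cotr: "(a, b) \<in> A \<union> B \<or> (b, c) \<in> A \<union> B" if "(a, c) \<in> A \<union> B" "a < b" "b < c" for a b c
    using that A B unfolding biclosed_def by blast
  have "(a, b) \<in> (A \<union> B)\<^sup>+ \<or> (b, c) \<in> (A \<union> B)\<^sup>+"
    if "(a, c) \<in> (A \<union> B)\<^sup>+" "a < b" "b < c" for a b c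
    using that
  proof (induction rule: trancl_induct)
    case (base y)
    then show ?case using cotr by blast
  next
    case (step y z)
    \<comment> \<open>If \<open>b\<close> lies before \<open>y\<close>, the induction hypothesis
      splits the initial chain; if \<open>b = y\<close>, the initial chain itself ends at
      \<open>b\<close>; if \<open>b\<close> lies after \<open>y\<close>, the last edge
      \<open>(y, z)\<close> is split.\<close>
    consider "b < y" | "b = y" | "y < b" by linarith
    then show ?case
    proof cases
      case 1
      then show ?thesis using step by (meson trancl.trancl_into_trancl)
    next
      case 2
      then show ?thesis using step by blast
    next
      case 3
      then have "(y, b) \<in> A \<union> B \<or> (b, z) \<in> A \<union> B"
        using step.hyps(2) step.prems cotr
        by blast
      then show ?thesis
        using step.hyps(1) by (meson trancl.trancl_into_trancl trancl.r_into_trancl)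
    qed
  qed
  then show ?thesis
    using pairs by (auto simp: biclosed_def)
qed

section \<open>Orders represented by inclusion of sets\<close>

lemma partial_order_of_sets:
  fixes L (structure)
  assumes "eq L = (=)"
    and "inj_on \<phi> (carrier L)"
    and "\<And>x y. x \<in> carrier L \<Longrightarrow> y \<in> carrier L \<Longrightarrow> x \<sqsubseteq> y \<longleftrightarrow> \<phi> x \<subseteq> \<phi> y"
  shows "partial_order L"
proof
  show "x .= y" if "x \<sqsubseteq> y" "y \<sqsubseteq> x" "x \<in> carrier L" "y \<in> carrier L" for x y
    using that assms by (auto dest: inj_onD)
qed (use assms in auto)

text \<open>Joins and set complements suffice, because complementation reverses inclusion and sends
  the bottom to a top. The set complement is also a lattice complement: a join may exceed the union,
  but here the union is already \<open>U\<close>; a meet may be smaller than the intersection, but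
  here the intersection is already empty.\<close>

lemma complemented_lattice_of_sets:
  fixes L (structure)
  assumes eq: "eq L = (=)"
    and inj: "inj_on \<phi> (carrier L)"
    and le: "\<And>x y. x \<in> carrier L \<Longrightarrow> y \<in> carrier L \<Longrightarrow> x \<sqsubseteq> y \<longleftrightarrow> \<phi> x \<subseteq> \<phi> y"
    and sub: "\<And>x. x \<in> carrier L \<Longrightarrow> \<phi> x \<subseteq> U"
    and empty: "\<exists>x \<in> carrier L. \<phi> x = {}"
    and compl: "\<And>x. x \<in> carrier L \<Longrightarrow> \<exists>y \<in> carrier L. \<phi> y = U - \<phi> x"
    and join: "\<And>x y. x \<in> carrier L \<Longrightarrow> y \<in> carrier L \<Longrightarrow>
      \<exists>z \<in> carrier L. \<phi> x \<union> \<phi> y \<subseteq> \<phi> z \<and> (\<forall>w \<in> carrier L. \<phi> x \<union> \<phi> y \<subseteq> \<phi> w \<longrightarrow> \<phi> z \<subseteq> \<phi> w)"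
  shows "complemented_lattice L"
proof -
  interpret partial_order L
    by (rule partial_order_of_sets[OF eq inj le])
  obtain b where b: "b \<in> carrier L" "\<phi> b = {}"
    using empty by blast
  obtain t where t: "t \<in> carrier L" "\<phi> t = U"
    using compl[OF b(1)] b by auto
  have lub: "\<exists>s. least L s (Upper L {x, y})" if xy: "x \<in> carrier L" "y \<in> carrier L" for x y
  proof -
    obtain z where "z \<in> carrier L" "\<phi> x \<union> \<phi> y \<subseteq> \<phi> z"
      "\<forall>w \<in> carrier L. \<phi> x \<union> \<phi> y \<subseteq> \<phi> w \<longrightarrow> \<phi> z \<subseteq> \<phi> w"
      using join[OF xy] by blast
    moreover have "Upper L {x, y} = {w \<in> carrier L. \<phi> x \<union> \<phi> y \<subseteq> \<phi> w}"
      using xy le by (auto simp: Upper_def)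
    ultimately show ?thesis
      by (intro exI[of _ z]) (auto simp: least_def le)
  qed
  have glb: "\<exists>s. greatest L s (Lower L {x, y})" if xy: "x \<in> carrier L" "y \<in> carrier L" for x y
  proof -
    \<comment> \<open>De Morgan: the meet is the complement of the join of the complements.\<close>
    obtain x' y' where x': "x' \<in> carrier L" "\<phi> x' = U - \<phi> x" and y': "y' \<in> carrier L" "\<phi> y' = U - \<phi> y"
      using compl xy by meson
    obtain z where z: "z \<in> carrier L" "\<phi> x' \<union> \<phi> y' \<subseteq> \<phi> z"
      "\<And>w. w \<in> carrier L \<Longrightarrow> \<phi> x' \<union> \<phi> y' \<subseteq> \<phi> w \<Longrightarrow> \<phi> z \<subseteq> \<phi> w"
      using join[OF x'(1) y'(1)] by blast
    obtain m where m: "m \<in> carrier L" "\<phi> m = U - \<phi> z"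
      using compl[OF z(1)] by blast
    have "\<phi> w \<subseteq> \<phi> m" if w: "w \<in> carrier L" "\<phi> w \<subseteq> \<phi> x" "\<phi> w \<subseteq> \<phi> y" for w
    proof -
      obtain w' where "w' \<in> carrier L" "\<phi> w' = U - \<phi> w"
        using compl[OF w(1)] by blast
      then show ?thesis
        using z(3)[of w'] w sub[OF w(1)] x' y' m by blast
    qed
    moreover have "\<phi> m \<subseteq> \<phi> x" "\<phi> m \<subseteq> \<phi> y"
      using m z(2) x' y' by blast+
    moreover have "Lower L {x, y} = {w \<in> carrier L. \<phi> w \<subseteq> \<phi> x \<and> \<phi> w \<subseteq> \<phi> y}"
      using xy le by (auto simp: Lower_def)
    ultimately show ?thesis
      using m(1) by (intro exI[of _ m]) (auto simp: greatest_def le)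
  qed
  interpret Lattice.bounded_lattice L
  proof
    show "\<exists>x. least L x (carrier L)"
      using b by (intro exI[of _ b]) (auto simp: least_def le)
    show "\<exists>x. greatest L x (carrier L)"
      using t sub by (intro exI[of _ t]) (auto simp: greatest_def le)
  qed (use lub glb in auto)
  show ?thesis
  proof
    fix x assume x: "x \<in> carrier L"
    obtain y where y: "y \<in> carrier L" "\<phi> y = U - \<phi> x"
      using compl[OF x] by blast
    have "\<phi> x \<subseteq> \<phi> (x \<squnion> y)" "\<phi> y \<subseteq> \<phi> (x \<squnion> y)"
      using join_left[OF x y(1)] join_right[OF x y(1)] le x y by auto
    then have "\<phi> t \<subseteq> \<phi> (x \<squnion> y)"
      using t y by blast
    then have "\<phi> w \<subseteq> \<phi> (x \<squnion> y)" if "w \<in> carrier L" for w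
      using sub[OF that] t by blast
    then have "x \<squnion> y = \<top>"
      using x y by (intro top_eq) (auto simp: le)
    moreover have "\<phi> (x \<sqinter> y) \<subseteq> \<phi> x" "\<phi> (x \<sqinter> y) \<subseteq> \<phi> y"
      using meet_left[OF x y(1)] meet_right[OF x y(1)] le x y by auto
    then have "\<phi> (x \<sqinter> y) = {}"
      using y by blast
    then have "x \<sqinter> y = \<bottom>"
      using x y by (intro bottom_eq) (auto simp: le)
    ultimately show "\<exists>y \<in> carrier L. x \<squnion> y = \<top> \<and> x \<sqinter> y = \<bottom>"
      using y by blast
  qed
qed

section \<open>Wachs permutations described through blocks\<close>

text \<open>Block \<open>p\<close> consists of the values \<open>2 * p - 1\<close> and \<open>2 * p\<close>;
  for odd \<open>n\<close> the last block is the singleton \<open>{n}\<close>.\<close>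

definition block :: "nat \<Rightarrow> nat" where
  "block a = (a + 1) div 2"

text \<open>Each block is represented by its odd value, which exists even when the last block is a
  singleton. For \<open>p = 0\<close> truncated subtraction yields the value 0, which lies in no
  value pair.\<close>

definition block_inversions :: "nat \<Rightarrow> (nat \<Rightarrow> nat) \<Rightarrow> (nat \<times> nat) set" where
  "block_inversions n \<sigma> = {(p, q). (2 * p - 1, 2 * q - 1) \<in> value_inversions n \<sigma>}"

definition flipped_blocks :: "nat \<Rightarrow> (nat \<Rightarrow> nat) \<Rightarrow> nat set" where
  "flipped_blocks n \<sigma> = {p. (2 * p - 1, 2 * p) \<in> value_inversions n \<sigma>}"

lemma block_cases:
  assumes "1 \<le> a"
  obtains "odd a" "a = 2 * block a - 1" | "even a" "a = 2 * block a" "2 * block a - 1 = a - 1"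
  using assms by (cases "even a") (auto simp: block_def elim!: evenE oddE)

lemma block_low:
  assumes "a \<in> {1..n}"
  shows "2 * block a - 1 \<in> {1..n}" "block (2 * block a - 1) = block a"
proof -
  have "1 \<le> a" "a \<le> n" using assms by auto
  then have "1 \<le> 2 * block a - 1 \<and> 2 * block a - 1 \<le> n \<and> block (2 * block a - 1) = block a"
    unfolding block_def by presburger
  then show "2 * block a - 1 \<in> {1..n}" "block (2 * block a - 1) = block a" by auto
qed

text \<open>Since \<open>i \<le> n - 1\<close>, an odd \<open>i\<close> has
  \<open>i + 1 \<le> n\<close>, so \<open>wachs_star\<close> returns the other value of the
  block.\<close>

lemma block_eq_iff:
  assumes "i \<in> {1..n - 1}" "1 \<le> c"
  shows "block c = block i \<longleftrightarrow> c = i \<or> c = wachs_star n i"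
  using assms by (auto simp: block_def wachs_star_def elim!: evenE oddE)

lemma wachs_star_mem: "i \<in> {1..n - 1} \<Longrightarrow> wachs_star n i \<in> {1..n}"
  by (auto simp: wachs_star_def elim!: evenE)

text \<open>No foreign value fits between two partners in adjacent positions, so both compare alike
  with it. Conversely, partners further apart enclose a position, and the value there belongs to
  another block and separates them. Comparing with the odd value \<open>2 * block a - 1\<close>
  treats both partners uniformly.\<close>

lemma wachs_perms_iff:
  "\<sigma> \<in> wachs_perms n \<longleftrightarrow> \<sigma> permutes {1..n} \<and>
     (\<forall>a\<in>{1..n}. \<forall>b\<in>{1..n}. block a \<noteq> block b \<longrightarrow>
       (pos \<sigma> a < pos \<sigma> b \<longleftrightarrow> pos \<sigma> (2 * block a - 1) < pos \<sigma> b))"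
  (is "_ \<longleftrightarrow> _ \<and> ?P")
proof (cases "\<sigma> permutes {1..n}")
  case s: True
  have "?P" if W: "\<forall>i\<in>{1..n - 1}. \<bar>int (pos \<sigma> i) - int (pos \<sigma> (wachs_star n i))\<bar> \<le> 1"
  proof (intro ballI impI)
    fix a b assume a: "a \<in> {1..n}" and b: "b \<in> {1..n}" and ne: "block a \<noteq> block b"
    have "1 \<le> a" using a by simp
    then show "pos \<sigma> a < pos \<sigma> b \<longleftrightarrow> pos \<sigma> (2 * block a - 1) < pos \<sigma> b"
    proof (cases rule: block_cases)
      case 2
      \<comment> \<open>For even \<open>a\<close> the adjacency condition is used at
        \<open>a - 1\<close>, which stays within \<open>{1..n - 1}\<close> even when
        \<open>a = n\<close>.\<close>
      have "a - 1 \<in> {1..n - 1}" "wachs_star n (a - 1) = a"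
        using 2(1) a by (auto simp: wachs_star_def elim!: evenE)
      then have "\<bar>int (pos \<sigma> (a - 1)) - int (pos \<sigma> a)\<bar> \<le> 1"
        using W by metis
      moreover have "b \<noteq> a" "b \<noteq> a - 1"
        using ne 2 by (auto simp: block_def)
      then have "pos \<sigma> b \<noteq> pos \<sigma> a" "pos \<sigma> b \<noteq> pos \<sigma> (a - 1)"
        using pos_eq_iff[OF s] by auto
      ultimately show ?thesis
        unfolding 2(3) by linarith
    qed simp
  qed
  moreover have "\<bar>int (pos \<sigma> i) - int (pos \<sigma> (wachs_star n i))\<bar> \<le> 1"
    if P: ?P and i: "i \<in> {1..n - 1}" for i
  proof (rule ccontr)
    let ?j = "wachs_star n i"
    assume far: "\<not> \<bar>int (pos \<sigma> i) - int (pos \<sigma> ?j)\<bar> \<le> 1"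
    have mem: "i \<in> {1..n}" "?j \<in> {1..n}"
      using i wachs_star_mem by auto
    then have pm: "pos \<sigma> i \<in> {1..n}" "pos \<sigma> ?j \<in> {1..n}"
      using permutes_in_image[OF permutes_inv[OF s]] by blast+
    have bij: "block ?j = block i"
      using block_eq_iff[OF i] mem by auto
    obtain r where r: "(pos \<sigma> i < r \<and> r < pos \<sigma> ?j) \<or> (pos \<sigma> ?j < r \<and> r < pos \<sigma> i)"
    proof (cases "pos \<sigma> i < pos \<sigma> ?j")
      case True
      then show thesis using that[of "pos \<sigma> i + 1"] far by auto
    next
      case False
      then show thesis using that[of "pos \<sigma> ?j + 1"] far by auto
    qed
    then have "r \<in> {1..n}" using pm by auto
    then have c: "\<sigma> r \<in> {1..n}" using permutes_in_image[OF s] by blast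
    have "\<sigma> r \<noteq> i" "\<sigma> r \<noteq> ?j"
      using r pos_apply[OF s, of r] by auto
    then have "block i \<noteq> block (\<sigma> r)"
      using block_eq_iff[OF i, of "\<sigma> r"] c by auto
    then have "pos \<sigma> i < pos \<sigma> (\<sigma> r) \<longleftrightarrow> pos \<sigma> ?j < pos \<sigma> (\<sigma> r)"
      using P mem c bij by metis
    then show False
      using r by (auto simp: pos_apply[OF s])
  qed
  ultimately show ?thesis
    using s by (auto simp: wachs_perms_def sym_group_carrier)
qed (simp add: wachs_perms_def sym_group_carrier)

lemma wachs_value_inversions_iff:
  assumes W: "\<sigma> \<in> wachs_perms n" and ab: "(a, b) \<in> value_pairs n" and ne: "block a \<noteq> block b"
  shows "(a, b) \<in> value_inversions n \<sigma> \<longleftrightarrow> (block a, block b) \<in> block_inversions n \<sigma>"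
proof -
  let ?low = "\<lambda>a. 2 * block a - 1"
  have s: "\<sigma> permutes {1..n}"
    and P: "\<And>a b. a \<in> {1..n} \<Longrightarrow> b \<in> {1..n} \<Longrightarrow> block a \<noteq> block b \<Longrightarrow>
       pos \<sigma> a < pos \<sigma> b \<longleftrightarrow> pos \<sigma> (?low a) < pos \<sigma> b"
    using W unfolding wachs_perms_iff by blast+
  have ab_mem: "a \<in> {1..n}" "b \<in> {1..n}"
    using ab by (auto simp: value_pairs_def)
  note mem = ab_mem block_low(1)[OF ab_mem(1)] block_low(1)[OF ab_mem(2)]
    and low = block_low(2)[OF ab_mem(1)] block_low(2)[OF ab_mem(2)]
  have "block a < block b"
    using ab ne by (auto simp: value_pairs_def block_def)
  then have pairs: "(?low a, ?low b) \<in> value_pairs n"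
    using mem by (auto simp: value_pairs_def)
  \<comment> \<open>The characterization replaces only the left argument of a comparison by its odd
    representative; turning the inequality round gives access to the other argument.\<close>
  have "pos \<sigma> b < pos \<sigma> a \<longleftrightarrow> pos \<sigma> (?low b) < pos \<sigma> a"
    using P mem ne by metis
  also have "\<dots> \<longleftrightarrow> \<not> pos \<sigma> a < pos \<sigma> (?low b)"
    using pos_less_swap[OF s, of a "?low b"] low ne by metis
  also have "\<dots> \<longleftrightarrow> \<not> pos \<sigma> (?low a) < pos \<sigma> (?low b)"
    using P[of a "?low b"] mem low ne by metis
  also have "\<dots> \<longleftrightarrow> pos \<sigma> (?low b) < pos \<sigma> (?low a)"
    using pos_less_swap[OF s, of "?low a" "?low b"] low ne by metis
  finally show ?thesis
    using ab pairs by (auto simp: value_inversions_def block_inversions_def)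
qed

lemma value_pairs_same_block:
  assumes "(a, b) \<in> value_pairs n" "block a = block b"
  shows "a = 2 * block a - 1 \<and> b = 2 * block a"
  using assms by (auto simp: value_pairs_def block_def)

text \<open>A value pair across two blocks is governed by the inversion of the blocks, and a pair
  inside one block is its flip, so together the two sets carry all value inversions.\<close>

lemma wachs_value_inversions_subset_iff:
  assumes s: "\<sigma> \<in> wachs_perms n" and t: "\<tau> \<in> wachs_perms n"
  shows "value_inversions n \<sigma> \<subseteq> value_inversions n \<tau> \<longleftrightarrow>
    block_inversions n \<sigma> \<subseteq> block_inversions n \<tau> \<and> flipped_blocks n \<sigma> \<subseteq> flipped_blocks n \<tau>"
    (is "?L \<longleftrightarrow> ?R")
proof
  show ?R if ?L
    using that by (auto simp: block_inversions_def flipped_blocks_def)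
  show ?L if R: ?R
  proof (rule subrelI)
    fix a b assume ab: "(a, b) \<in> value_inversions n \<sigma>"
    then have pair: "(a, b) \<in> value_pairs n"
      using value_inversions_subset by blast
    show "(a, b) \<in> value_inversions n \<tau>"
    proof (cases "block a = block b")
      case True
      then have "a = 2 * block a - 1 \<and> b = 2 * block a"
        by (rule value_pairs_same_block[OF pair])
      then show ?thesis
        using R ab unfolding flipped_blocks_def by (metis (mono_tags, lifting) mem_Collect_eq subsetD)
    next
      case False
      then show ?thesis
        using R ab wachs_value_inversions_iff[OF s pair] wachs_value_inversions_iff[OF t pair] by blast
    qed
  qed
qed

text \<open>The set is the pullback of a biclosed set along the increasing map from \<open>p\<close>
  to \<open>2 * p - 1\<close>.\<close>

lemma biclosed_block_inversions:
  assumes "\<sigma> \<in> wachs_perms n"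
  shows "biclosed ((n + 1) div 2) (block_inversions n \<sigma>)"
proof -
  have "biclosed n (value_inversions n \<sigma>)"
    using assms biclosed_value_inversions by (simp add: wachs_perms_iff)
  then have sub: "value_inversions n \<sigma> \<subseteq> value_pairs n"
    and tr: "\<And>a b c. (a, b) \<in> value_inversions n \<sigma> \<Longrightarrow> (b, c) \<in> value_inversions n \<sigma> \<Longrightarrow>
      (a, c) \<in> value_inversions n \<sigma>"
    and cotr: "\<And>a b c. (a, c) \<in> value_inversions n \<sigma> \<Longrightarrow> a < b \<Longrightarrow> b < c \<Longrightarrow>
      (a, b) \<in> value_inversions n \<sigma> \<or> (b, c) \<in> value_inversions n \<sigma>"
    unfolding biclosed_def trans_def by blast+
  have "block_inversions n \<sigma> \<subseteq> value_pairs ((n + 1) div 2)"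
    using sub by (force simp: block_inversions_def value_pairs_def)
  moreover have "trans (block_inversions n \<sigma>)"
    by (rule transI) (use tr in \<open>auto simp: block_inversions_def\<close>)
  moreover have "(p, q) \<in> block_inversions n \<sigma> \<or> (q, r) \<in> block_inversions n \<sigma>"
    if "(p, r) \<in> block_inversions n \<sigma>" "p < q" "q < r" for p q r
    using that cotr[of "2 * p - 1" "2 * r - 1" "2 * q - 1"] sub
    by (auto simp: block_inversions_def value_pairs_def)
  ultimately show ?thesis
    unfolding biclosed_def by blast
qed

lemma flipped_blocks_subset: "flipped_blocks n \<sigma> \<subseteq> {1..n div 2}"
  by (auto simp: flipped_blocks_def value_inversions_def value_pairs_def)

text \<open>The prescribed data force the set \<open>J\<close> of value inversions, so it remains to
  see that \<open>J\<close> is biclosed and that its permutation keeps the blocks together.\<close>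

lemma wachs_perm_exists:
  assumes I: "biclosed ((n + 1) div 2) I" and X: "X \<subseteq> {1..n div 2}"
  obtains \<sigma> where "\<sigma> \<in> wachs_perms n" "block_inversions n \<sigma> = I" "flipped_blocks n \<sigma> = X"
proof -
  define J where "J = {(a, b) \<in> value_pairs n.
    if block a = block b then block a \<in> X else (block a, block b) \<in> I}"
  have sub: "I \<subseteq> value_pairs ((n + 1) div 2)"
    and tr: "\<And>a b c. (a, b) \<in> I \<Longrightarrow> (b, c) \<in> I \<Longrightarrow> (a, c) \<in> I"
    and cotr: "\<And>a b c. (a, c) \<in> I \<Longrightarrow> a < b \<Longrightarrow> b < c \<Longrightarrow> (a, b) \<in> I \<or> (b, c) \<in> I"
    using I unfolding biclosed_def trans_def by blast+
  have mono: "block a \<le> block b" if "a < b" for a b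
    using that by (auto simp: block_def intro: div_le_mono)
  \<comment> \<open>No three values share a block. When \<open>a < b < c\<close> meet two blocks,
    one of the two neighbouring pairs lies across them and has the same block pair as
    \<open>(a, c)\<close>; when they meet three, the closure properties of \<open>I\<close>
    apply.\<close>
  have no3: "\<not> (block a = block b \<and> block b = block c)" if "1 \<le> a" "a < b" "b < c" for a b c
    using that by (auto simp: block_def)
  have "(a, c) \<in> J" if "(a, b) \<in> J" "(b, c) \<in> J" for a b c
    using that no3[of a b c] mono[of a b] mono[of b c] tr[of "block a" "block b" "block c"]
    by (auto simp: J_def value_pairs_def split: if_splits)
  moreover have "(a, b) \<in> J \<or> (b, c) \<in> J" if "(a, c) \<in> J" "a < b" "b < c" for a b c
    using that no3[of a b c] mono[of a b] mono[of b c] cotr[of "block a" "block c" "block b"]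
    by (auto simp: J_def value_pairs_def split: if_splits)
  ultimately have "biclosed n J"
    unfolding biclosed_def trans_def J_def by blast
  then obtain \<sigma> where s: "\<sigma> permutes {1..n}" and inv: "value_inversions n \<sigma> = J"
    by (rule biclosed_realized)
  \<comment> \<open>For values of different blocks the right-hand side depends on the blocks alone,
    so replacing \<open>a\<close> by its odd representative changes nothing.\<close>
  have lt: "pos \<sigma> a < pos \<sigma> b \<longleftrightarrow>
      (if block a < block b then (block a, block b) \<notin> I else (block b, block a) \<in> I)"
    if "a \<in> {1..n}" "b \<in> {1..n}" "block a \<noteq> block b" for a b
  proof (cases "a < b")
    case True
    then have "pos \<sigma> a < pos \<sigma> b \<longleftrightarrow> (a, b) \<notin> J"
      using that pos_less_swap[OF s, of a b] unfolding inv[symmetric]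
      by (auto simp: value_inversions_def value_pairs_def)
    then show ?thesis
      using that True mono[OF True] by (auto simp: J_def value_pairs_def)
  next
    case False
    then have ba: "b < a" using that by (cases "a = b") auto
    then have "pos \<sigma> a < pos \<sigma> b \<longleftrightarrow> (b, a) \<in> J"
      using that unfolding inv[symmetric]
      by (auto simp: value_inversions_def value_pairs_def)
    then show ?thesis
      using that mono[OF ba] ba by (auto simp: J_def value_pairs_def)
  qed
  have "\<sigma> \<in> wachs_perms n"
    unfolding wachs_perms_iff
  proof (intro conjI s ballI impI)
    fix a b assume ab: "a \<in> {1..n}" "b \<in> {1..n}" "block a \<noteq> block b"
    show "pos \<sigma> a < pos \<sigma> b \<longleftrightarrow> pos \<sigma> (2 * block a - 1) < pos \<sigma> b"
      using lt[OF ab] lt[OF block_low(1)[OF ab(1)] ab(2)] block_low(2)[OF ab(1)] ab(3) by simp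
  qed
  moreover have "block_inversions n \<sigma> = I"
  proof -
    have odd: "block (2 * p - 1) = p" for p
      by (cases p) (auto simp: block_def)
    \<comment> \<open>This covers all naturals, including \<open>p = 0\<close> and
      \<open>p = q\<close>: there the left side fails by \<open>value_pairs n\<close> and the right
      side by \<open>sub\<close>.\<close>
    have "(2 * p - 1, 2 * q - 1) \<in> J \<longleftrightarrow> (p, q) \<in> I" for p q
      using sub by (auto simp del: One_nat_def simp: J_def odd value_pairs_def)
    then show ?thesis
      by (simp add: block_inversions_def inv)
  qed
  moreover have "flipped_blocks n \<sigma> = X"
  proof -
    have "(2 * p - 1, 2 * p) \<in> J \<longleftrightarrow> p \<in> X" for p
    proof -
      have "block (2 * p - 1) = p" "block (2 * p) = p"
        by (cases p) (auto simp: block_def)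
      moreover have "(2 * p - 1, 2 * p) \<in> value_pairs n \<longleftrightarrow> p \<in> {1..n div 2}"
        by (auto simp: value_pairs_def)
      ultimately show ?thesis
        using X by (auto simp del: One_nat_def simp: J_def)
    qed
    then show ?thesis
      by (simp add: flipped_blocks_def inv)
  qed
  ultimately show thesis
    by (rule that)
qed

section \<open>The isomorphism and the complemented lattice\<close>

lemma wachs_order_le_iff:
  assumes "\<sigma> \<in> wachs_perms n" "\<tau> \<in> wachs_perms n"
  shows "weak_le n \<sigma> \<tau> \<longleftrightarrow>
    block_inversions n \<sigma> \<subseteq> block_inversions n \<tau> \<and> flipped_blocks n \<sigma> \<subseteq> flipped_blocks n \<tau>"
  using assms weak_le_iff wachs_value_inversions_subset_iff by (simp add: wachs_perms_iff)

lemma wachs_inject: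
  assumes s: "\<sigma> \<in> wachs_perms n" and t: "\<tau> \<in> wachs_perms n"
    and "block_inversions n \<sigma> = block_inversions n \<tau>" "flipped_blocks n \<sigma> = flipped_blocks n \<tau>"
  shows "\<sigma> = \<tau>"
proof (rule value_inversions_inject)
  show "value_inversions n \<sigma> = value_inversions n \<tau>"
    using wachs_value_inversions_subset_iff[OF s t] wachs_value_inversions_subset_iff[OF t s] assms
    by auto
qed (use s t in \<open>simp_all add: wachs_perms_iff\<close>)

text \<open>The disjoint sum packs a pair of sets into one set with componentwise inclusion, so the
  criteria for orders represented by sets apply to pairs.\<close>

lemma Plus_subset_iff: "A <+> B \<subseteq> C <+> D \<longleftrightarrow> A \<subseteq> C \<and> B \<subseteq> D"
  by (auto simp: Plus_def)

lemma partial_order_prod_weak_powerset: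
  "partial_order (prod_gorder (weak_order k) (powerset_order A))"
proof (rule partial_order_of_sets[where \<phi> = "\<lambda>(u, X). value_inversions k u <+> X"])
  show "inj_on (\<lambda>(u, X). value_inversions k u <+> X)
      (carrier (prod_gorder (weak_order k) (powerset_order A)))"
    by (rule inj_onI)
      (auto simp: prod_gorder_def weak_order_def powerset_order_def sym_group_carrier
        set_eq_subset Plus_subset_iff intro!: value_inversions_inject)
qed (auto simp: prod_gorder_def weak_order_def powerset_order_def fun_eq_iff prod_eq_iff
      sym_group_carrier weak_le_iff Plus_subset_iff)

lemma inj_on_wachs_sets:
  "inj_on (\<lambda>\<sigma>. block_inversions n \<sigma> <+> flipped_blocks n \<sigma>) (wachs_perms n)"
  by (rule inj_onI, rule wachs_inject) (auto simp: set_eq_subset Plus_subset_iff)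

lemma partial_order_wachs: "partial_order (wachs_order n)"
  by (rule partial_order_of_sets[where \<phi> = "\<lambda>\<sigma>. block_inversions n \<sigma> <+> flipped_blocks n \<sigma>"])
    (simp_all add: wachs_order_def inj_on_wachs_sets wachs_order_le_iff Plus_subset_iff)

lemma poset_isomorphic_wachs:
  "poset_isomorphic (wachs_order n)
     (prod_gorder (weak_order ((n + 1) div 2)) (powerset_order {1..n div 2}))"
proof -
  let ?m = "(n + 1) div 2"
  \<comment> \<open>The first component lists the blocks in the order in which they occur in the
    Wachs permutation.\<close>
  define f where "f \<sigma> = (perm_of_inversions ?m (block_inversions n \<sigma>), flipped_blocks n \<sigma>)" for \<sigma>
  have f: "fst (f \<sigma>) permutes {1..?m} \<and> value_inversions ?m (fst (f \<sigma>)) = block_inversions n \<sigma>"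
    if "\<sigma> \<in> wachs_perms n" for \<sigma>
    unfolding f_def fst_conv by (rule perm_of_inversions[OF biclosed_block_inversions[OF that]])
  have "inj_on f (wachs_perms n)"
  proof (rule inj_onI)
    fix \<sigma> \<tau> assume s: "\<sigma> \<in> wachs_perms n" and t: "\<tau> \<in> wachs_perms n" and eq: "f \<sigma> = f \<tau>"
    have "block_inversions n \<sigma> = block_inversions n \<tau>"
      using f[OF s] f[OF t] eq by simp
    moreover have "flipped_blocks n \<sigma> = flipped_blocks n \<tau>"
      using eq by (simp add: f_def)
    ultimately show "\<sigma> = \<tau>"
      by (rule wachs_inject[OF s t])
  qed
  moreover have "f ` wachs_perms n = {u. u permutes {1..?m}} \<times> Pow {1..n div 2}"
  proof (intro equalityI subsetI)
    fix x assume "x \<in> f ` wachs_perms n"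
    then obtain \<sigma> where "\<sigma> \<in> wachs_perms n" "x = f \<sigma>"
      by blast
    then show "x \<in> {u. u permutes {1..?m}} \<times> Pow {1..n div 2}"
      using f[of \<sigma>] flipped_blocks_subset[of n \<sigma>] by (simp add: f_def)
  next
    fix x assume "x \<in> {u. u permutes {1..?m}} \<times> Pow {1..n div 2}"
    then obtain u X where x: "x = (u, X)" and u: "u permutes {1..?m}" and X: "X \<subseteq> {1..n div 2}"
      by auto
    obtain \<sigma> where "\<sigma> \<in> wachs_perms n" "block_inversions n \<sigma> = value_inversions ?m u"
      "flipped_blocks n \<sigma> = X"
      by (rule wachs_perm_exists[OF biclosed_value_inversions[OF u] X])
    then show "x \<in> f ` wachs_perms n"
      using perm_of_value_inversions[OF u] by (intro image_eqI[of _ _ \<sigma>]) (simp_all add: f_def x)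
  qed
  ultimately have "bij_betw f (carrier (wachs_order n))
      (carrier (prod_gorder (weak_order ?m) (powerset_order {1..n div 2})))"
    by (simp add: bij_betw_def wachs_order_def prod_gorder_def weak_order_def powerset_order_def
        sym_group_def)
  moreover have "weak_le ?m (fst (f \<sigma>)) (fst (f \<tau>)) \<and> snd (f \<sigma>) \<subseteq> snd (f \<tau>) \<longleftrightarrow> weak_le n \<sigma> \<tau>"
    if "\<sigma> \<in> wachs_perms n" "\<tau> \<in> wachs_perms n" for \<sigma> \<tau>
    using f[OF that(1)] f[OF that(2)] wachs_order_le_iff[OF that] weak_le_iff
    by (simp add: f_def)
  then have "order_emb (wachs_order n) (prod_gorder (weak_order ?m) (powerset_order {1..n div 2})) f"
    using partial_order.axioms(1)[OF partial_order_wachs]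
      partial_order.axioms(1)[OF partial_order_prod_weak_powerset]
    by (simp add: order_emb_def wachs_order_def prod_gorder_def weak_order_def powerset_order_def)
  ultimately show ?thesis
    unfolding poset_isomorphic_def by blast
qed

text \<open>Wachs permutations realize all pairs of a biclosed set on the blocks and a set of flips.
  Complements are taken componentwise; a join takes the transitive closure of the union in the first
  component and the plain union in the second.\<close>

lemma complemented_lattice_wachs: "complemented_lattice (wachs_order n)"
proof (rule complemented_lattice_of_sets)
  let ?m = "(n + 1) div 2"
  let ?\<phi> = "\<lambda>\<sigma>. block_inversions n \<sigma> <+> flipped_blocks n \<sigma>"
  let ?U = "value_pairs ?m <+> {1..n div 2}"
  have carrier: "carrier (wachs_order n) = wachs_perms n"
    by (simp add: wachs_order_def)
  show "eq (wachs_order n) = (=)" "inj_on ?\<phi> (carrier (wachs_order n))"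
    by (simp_all add: wachs_order_def inj_on_wachs_sets)
  show "\<sigma> \<sqsubseteq>\<^bsub>wachs_order n\<^esub> \<tau> \<longleftrightarrow> ?\<phi> \<sigma> \<subseteq> ?\<phi> \<tau>"
    if "\<sigma> \<in> carrier (wachs_order n)" "\<tau> \<in> carrier (wachs_order n)" for \<sigma> \<tau>
    using that by (simp add: wachs_order_def wachs_order_le_iff Plus_subset_iff)
  show "?\<phi> \<sigma> \<subseteq> ?U" if "\<sigma> \<in> carrier (wachs_order n)" for \<sigma>
    using that biclosed_block_inversions flipped_blocks_subset
    unfolding Plus_subset_iff biclosed_def carrier by blast
  show "\<exists>\<sigma> \<in> carrier (wachs_order n). ?\<phi> \<sigma> = {}"
    unfolding carrier by (rule wachs_perm_exists[OF biclosed_empty empty_subsetI]) auto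
  show "\<exists>\<tau> \<in> carrier (wachs_order n). ?\<phi> \<tau> = ?U - ?\<phi> \<sigma>"
    if "\<sigma> \<in> carrier (wachs_order n)" for \<sigma>
  proof -
    have "biclosed ?m (value_pairs ?m - block_inversions n \<sigma>)"
      using that biclosed_complement biclosed_block_inversions by (simp add: carrier)
    then obtain \<tau> where "\<tau> \<in> wachs_perms n"
      "block_inversions n \<tau> = value_pairs ?m - block_inversions n \<sigma>"
      "flipped_blocks n \<tau> = {1..n div 2} - flipped_blocks n \<sigma>"
      by (rule wachs_perm_exists[OF _ Diff_subset])
    then show ?thesis
      by (intro bexI[of _ \<tau>]) (auto simp: carrier)
  qed
  show "\<exists>\<rho> \<in> carrier (wachs_order n). ?\<phi> \<sigma> \<union> ?\<phi> \<tau> \<subseteq> ?\<phi> \<rho> \<and>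
      (\<forall>\<omega> \<in> carrier (wachs_order n). ?\<phi> \<sigma> \<union> ?\<phi> \<tau> \<subseteq> ?\<phi> \<omega> \<longrightarrow> ?\<phi> \<rho> \<subseteq> ?\<phi> \<omega>)"
    if "\<sigma> \<in> carrier (wachs_order n)" "\<tau> \<in> carrier (wachs_order n)" for \<sigma> \<tau>
  proof -
    let ?A = "block_inversions n \<sigma> \<union> block_inversions n \<tau>"
    let ?X = "flipped_blocks n \<sigma> \<union> flipped_blocks n \<tau>"
    have "biclosed ?m (?A\<^sup>+)"
      using that biclosed_trancl_Un biclosed_block_inversions by (simp add: carrier)
    moreover have "?X \<subseteq> {1..n div 2}"
      using flipped_blocks_subset by simp
    ultimately obtain \<rho> where \<rho>: "\<rho> \<in> wachs_perms n"
      "block_inversions n \<rho> = ?A\<^sup>+" "flipped_blocks n \<rho> = ?X"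
      by (rule wachs_perm_exists)
    have "?A\<^sup>+ \<subseteq> block_inversions n \<omega>"
      if "\<omega> \<in> wachs_perms n" "?A \<subseteq> block_inversions n \<omega>" for \<omega>
    proof -
      have "trans (block_inversions n \<omega>)"
        using biclosed_block_inversions[OF that(1)] by (simp add: biclosed_def)
      \<comment> \<open>A transitive relation containing the union contains its transitive closure,
        which makes the constructed upper bound least.\<close>
      then show ?thesis
        using trancl_mono_subset[OF that(2)] by (simp add: trancl_id)
    qed
    moreover have "?A \<subseteq> ?A\<^sup>+"
      by auto
    ultimately show ?thesis
      using \<rho> unfolding carrier
      by (intro bexI[of _ \<rho>]) (auto simp only: Un_subset_iff Plus_subset_iff)
  qed
qed

theorem theorem5p3:
  fixes n :: nat
  assumes "n > 0"
  shows "poset_isomorphic (wachs_order n)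
           (prod_gorder (weak_order (nat \<lceil>real n / 2\<rceil>))
                        (powerset_order {1..nat \<lfloor>real n / 2\<rfloor>}))
         \<and> complemented_lattice (wachs_order n)"
proof -
  \<comment> \<open>The floor counts the two-element blocks and the ceiling counts all
    blocks.\<close>
  have "nat \<lfloor>real n / 2\<rfloor> = n div 2"
    by linarith
  moreover have "nat \<lceil>real n / 2\<rceil> = (n + 1) div 2"
    by linarith
  ultimately show ?thesis
    using poset_isomorphic_wachs complemented_lattice_wachs by simp
qed

end
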